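(* Let $G=(U,V,E)$, $w:E\to\mathbb{R}$ with $w_{ij}>0$ for all $(i,j)\in E$, be an assignment game. For every team $e=(i,j)\in E$: $e$ is always paid fairly (i.e. $y_i+y_j=w_e$ for every imputation $y$ in the core) if and only if $e$ is viable or essential.
   Context: Assignment game: $G=(U,V,E)$ is a finite bipartite graph with bipartition $U,V$ and edge weights $w_{ij}>0$. The players are the vertices $U\cup V$, and the teams are the edges. The worth $p(S_u\cup S_v)$ of a coalition $S_u\cup S_v$ ($S_u\subseteq U$, $S_v\subseteq V$) is the weight of a maximum weight matching in the subgraph of $G$ induced on $S_u\cup S_v$. An imputation is a function $y:U\cup V\to\mathbb{R}_{\ge 0}$ with $\sum_{q\in U\cup V}y_q=p(U\cup V)$. It is in the core if $\sum_{q\in S_u\cup S_v}y_q\ge p(S_u\cup S_v)$ for every coalition. A team $e\in E$ is essential if $e$ belongs to every maximum weight matching in $G$. It is viable if there is a maximum weight matching $M$ with $e\in M$ and another one $M'$ with $e\notin M'$. A team $e=(i,j)$ is fairly paid in a core imputation $y$ if $y_i+y_j=w_e$, and is always paid fairly if it is fairly paid in every core imputation. *)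

theory Defs
  imports Complex_Main
begin

text \<open>
  An edge is a pair whose first component lies in \<open>U\<close> and whose second component lies in \<open>V\<close>.
  The weight function is total on pairs, but only its values on \<open>E\<close> are ever used.
\<close>

locale assignment_game =
  fixes U V :: "'a set" and E :: "('a \<times> 'a) set" and w :: "'a \<times> 'a \<Rightarrow> real"
  assumes finite_U: "finite U"
    and finite_V: "finite V"
    and disjoint: "U \<inter> V = {}"
    and edges: "E \<subseteq> U \<times> V"
    and weight_pos: "e \<in> E \<Longrightarrow> w e > 0"

definition matching :: "('a \<times> 'a) set \<Rightarrow> ('a \<times> 'a) set \<Rightarrow> bool" where
  "matching E M \<longleftrightarrow> M \<subseteq> E \<and>
     (\<forall>e\<in>M. \<forall>f\<in>M. e \<noteq> f \<longrightarrow> {fst e, snd e} \<inter> {fst f, snd f} = {})"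

definition max_weight_matching ::
    "('a \<times> 'a) set \<Rightarrow> ('a \<times> 'a \<Rightarrow> real) \<Rightarrow> ('a \<times> 'a) set \<Rightarrow> bool" where
  "max_weight_matching E w M \<longleftrightarrow> matching E M \<and> (\<forall>M'. matching E M' \<longrightarrow> sum w M' \<le> sum w M)"

text \<open>
  The edges of the subgraph induced on \<open>Su \<union> Sv\<close>, with \<open>Su \<subseteq> U\<close> and \<open>Sv \<subseteq> V\<close>,
  are those in \<open>E \<inter> Su \<times> Sv\<close>.
\<close>

definition worth ::
    "('a \<times> 'a) set \<Rightarrow> ('a \<times> 'a \<Rightarrow> real) \<Rightarrow> 'a set \<Rightarrow> 'a set \<Rightarrow> real" where
  "worth E w Su Sv = Max {sum w M | M. matching (E \<inter> Su \<times> Sv) M}"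

text \<open>
  An imputation is a total function of which only the values on \<open>U \<union> V\<close> are constrained.
\<close>

definition imputation ::
    "'a set \<Rightarrow> 'a set \<Rightarrow> ('a \<times> 'a) set \<Rightarrow> ('a \<times> 'a \<Rightarrow> real) \<Rightarrow> ('a \<Rightarrow> real) \<Rightarrow> bool" where
  "imputation U V E w y \<longleftrightarrow> (\<forall>q\<in>U \<union> V. 0 \<le> y q) \<and> (\<Sum>q\<in>U \<union> V. y q) = worth E w U V"

definition core ::
    "'a set \<Rightarrow> 'a set \<Rightarrow> ('a \<times> 'a) set \<Rightarrow> ('a \<times> 'a \<Rightarrow> real) \<Rightarrow> ('a \<Rightarrow> real) set" where
  "core U V E w = {y. imputation U V E w y \<and>
     (\<forall>Su Sv. Su \<subseteq> U \<longrightarrow> Sv \<subseteq> V \<longrightarrow> (\<Sum>q\<in>Su \<union> Sv. y q) \<ge> worth E w Su Sv)}"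

definition essential ::
    "('a \<times> 'a) set \<Rightarrow> ('a \<times> 'a \<Rightarrow> real) \<Rightarrow> 'a \<times> 'a \<Rightarrow> bool" where
  "essential E w e \<longleftrightarrow> (\<forall>M. max_weight_matching E w M \<longrightarrow> e \<in> M)"

definition viable ::
    "('a \<times> 'a) set \<Rightarrow> ('a \<times> 'a \<Rightarrow> real) \<Rightarrow> 'a \<times> 'a \<Rightarrow> bool" where
  "viable E w e \<longleftrightarrow> (\<exists>M. max_weight_matching E w M \<and> e \<in> M) \<and>
     (\<exists>M'. max_weight_matching E w M' \<and> e \<notin> M')"

definition fairly_paid ::
    "('a \<times> 'a \<Rightarrow> real) \<Rightarrow> ('a \<Rightarrow> real) \<Rightarrow> 'a \<times> 'a \<Rightarrow> bool" where
  "fairly_paid w y e \<longleftrightarrow> y (fst e) + y (snd e) = w e"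

definition always_paid_fairly ::
    "'a set \<Rightarrow> 'a set \<Rightarrow> ('a \<times> 'a) set \<Rightarrow> ('a \<times> 'a \<Rightarrow> real) \<Rightarrow> 'a \<times> 'a \<Rightarrow> bool" where
  "always_paid_fairly U V E w e \<longleftrightarrow> (\<forall>y\<in>core U V E w. fairly_paid w y e)"

text \<open>
  For finite \<open>E\<close> the maximum in \<^const>\<open>worth\<close> is taken over a finite nonempty set, and it is
  attained exactly by the maximum weight matchings of the induced subgraph.
\<close>

lemma finite_matchings:
  assumes "finite E"
  shows "finite {M. matching E M}"
  by (rule finite_subset[of _ "Pow E"]) (use assms in \<open>auto simp: matching_def\<close>)

lemma worth_eq_iff:
  assumes "finite E" and M: "matching (E \<inter> Su \<times> Sv) M"
  shows "sum w M = worth E w Su Sv \<longleftrightarrow> max_weight_matching (E \<inter> Su \<times> Sv) w M"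
proof -
  have fin: "finite {sum w M | M. matching (E \<inter> Su \<times> Sv) M}"
    using finite_matchings[of "E \<inter> Su \<times> Sv"] assms(1) by (simp add: setcompr_eq_image)
  have ne: "{sum w M | M. matching (E \<inter> Su \<times> Sv) M} \<noteq> {}"
    using M by blast
  show ?thesis
    unfolding worth_def max_weight_matching_def eq_Max_iff[OF fin ne] using M by blast
qed

end

theory Submission
  imports Defs
begin

text \<open>
  If \<open>e\<close> lies in some maximum weight matching \<open>M\<close>, then complementary slackness along \<open>M\<close> forces
  \<open>e\<close> to be fairly paid. If it lies in none, the weight of \<open>e\<close> can be raised by a positive amount
  \<open>\<epsilon>\<close> without changing the worth of the game; a core imputation of the modified game is one of the
  original game, and it pays \<open>e\<close> at least \<open>w e + \<epsilon>\<close>.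

  Nonemptiness of the core is shown by the imputation that is optimal for \<open>V\<close>: each \<open>v \<in> V\<close>
  receives its marginal contribution, and the partner of \<open>v\<close> in a fixed maximum weight
  matching receives the rest of the weight of their edge. That this covers every edge follows by
  augmenting two matchings by an edge, after exchanging them along an alternating component.
\<close>

section \<open>Matchings as edge sets injective in both coordinates, and alternating
  exchange\<close>

lemma matching_bipartite_iff:
  assumes "E \<subseteq> U \<times> V" "U \<inter> V = {}"
  shows "matching E M \<longleftrightarrow> M \<subseteq> E \<and> inj_on fst M \<and> inj_on snd M"
proof
  assume "matching E M"
  then show "M \<subseteq> E \<and> inj_on fst M \<and> inj_on snd M"
    unfolding matching_def inj_on_def by blast
next
  assume *: "M \<subseteq> E \<and> inj_on fst M \<and> inj_on snd M"
  have "{fst e, snd e} \<inter> {fst f, snd f} = {}" if "e \<in> M" "f \<in> M" "e \<noteq> f" for e f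
  proof -
    have "fst e \<noteq> fst f" "snd e \<noteq> snd f"
      using * that by (auto dest: inj_onD)
    moreover have "e \<in> U \<times> V" "f \<in> U \<times> V"
      using * that assms(1) by auto
    ultimately show ?thesis
      using assms(2) by auto
  qed
  then show "matching E M"
    using * by (simp add: matching_def)
qed

text \<open>
  The set \<open>R\<close> collects the first components of the edges on the alternating path from \<open>u\<close>;
  \<open>A\<close> and \<open>B\<close> are exchanged on the edges with first component in \<open>R\<close>. The path enters
  second components by edges of \<open>A\<close> only, so it cannot reach \<open>v\<close>.
\<close>

lemma augment_two_injective:
  fixes w :: "'a \<times> 'b \<Rightarrow> real"
  assumes fin: "finite A" "finite B"
    and A: "inj_on fst A" "inj_on snd A"
    and B: "inj_on fst B" "inj_on snd B"
    and u: "u \<notin> fst ` B" and v: "v \<notin> snd ` A"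
  obtains A' B' where
    "inj_on fst A'" "inj_on snd A'" "inj_on fst B'" "inj_on snd B'"
    "A' \<union> B' = insert (u, v) (A \<union> B)"
    "sum w A' + sum w B' = sum w A + sum w B + w (u, v)"
    "snd ` A' \<inter> snd ` B' \<subseteq> insert v (snd ` A \<inter> snd ` B)"
proof -
  define R where "R = {x. (u, x) \<in> {(x, x'). \<exists>z. (x, z) \<in> A \<and> (x', z) \<in> B}\<^sup>*}"
  have uR: "u \<in> R"
    by (simp add: R_def)
  have fwd: "x' \<in> R" if "x \<in> R" "(x, z) \<in> A" "(x', z) \<in> B" for x x' z
    using that unfolding R_def by (auto intro: rtrancl_into_rtrancl)
  have pred: "\<exists>x z. x \<in> R \<and> (x, z) \<in> A \<and> (x', z) \<in> B" if "x' \<in> R" "x' \<noteq> u" for x'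
    using that(1)[unfolded R_def mem_Collect_eq]
    by (cases rule: rtranclE) (use that(2) in \<open>auto simp: R_def\<close>)
  \<comment> \<open>The step that brought \<open>x'\<close> into \<open>R\<close> can be retraced:
    the \<open>B\<close>-edge at \<open>x'\<close> is unique, and so is the \<open>A\<close>-edge at
    its other end. The start \<open>u\<close> has no \<open>B\<close>-edge, so it is never
    \<open>x'\<close> here.\<close>
  have bwd: "x \<in> R" if "x' \<in> R" "(x, z) \<in> A" "(x', z) \<in> B" for x x' z
  proof -
    have "x' \<noteq> u"
      using u that(3) by force
    then obtain x0 z0 where "x0 \<in> R" "(x0, z0) \<in> A" "(x', z0) \<in> B"
      using pred[OF \<open>x' \<in> R\<close>] by blast
    moreover from this have "z0 = z"
      using inj_onD[OF B(1), of "(x', z0)" "(x', z)"] that(3) by simp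
    ultimately show ?thesis
      using inj_onD[OF A(2), of "(x0, z)" "(x, z)"] that(2) by simp
  qed
  define AR where "AR = {e \<in> A. fst e \<in> R}"
  define AN where "AN = {e \<in> A. fst e \<notin> R}"
  define BR where "BR = {e \<in> B. fst e \<in> R}"
  define BN where "BN = {e \<in> B. fst e \<notin> R}"
  note parts = AR_def AN_def BR_def BN_def
  \<comment> \<open>\<open>C\<close> gives up the \<open>A\<close>-edges at \<open>R\<close> in
    favour of the \<open>B\<close>-edges there, which leaves both \<open>u\<close> and
    \<open>v\<close> free in \<open>C\<close>; \<open>D\<close> takes the remaining edges. By
    \<open>fwd\<close> and \<open>bwd\<close>, edges from different sides of the cut at
    \<open>R\<close> never clash in second components.\<close>
  define C where "C = AN \<union> BR"
  define D where "D = AR \<union> BN"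
  have fins: "finite AR" "finite AN" "finite BR" "finite BN"
    using fin by (auto simp: parts)
  have R_iff: "fst e \<in> R \<longleftrightarrow> fst f \<in> R" if "e \<in> A" "f \<in> B" "snd e = snd f" for e f
    using fwd[of "fst e" "snd e" "fst f"] bwd[of "fst f" "fst e" "snd e"] that
    by (cases e; cases f) auto
  have snd_AN_BR: "snd ` AN \<inter> snd ` BR = {}"
    unfolding parts using R_iff by blast
  have snd_AR_BN: "snd ` AR \<inter> snd ` BN = {}"
    unfolding parts using R_iff by blast
  have fst_AN_BR: "fst ` AN \<inter> fst ` BR = {}" and fst_AR_BN: "fst ` AR \<inter> fst ` BN = {}"
    by (auto simp: parts)
  have subs: "AN \<subseteq> A" "AR \<subseteq> A" "BN \<subseteq> B" "BR \<subseteq> B"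
    by (auto simp: parts)
  have AB: "AN \<union> AR = A" "BN \<union> BR = B" "AN \<inter> AR = {}" "BN \<inter> BR = {}"
    by (auto simp: parts)
  have inj_Un: "inj_on f (X \<union> Y)"
    if "inj_on f X" "inj_on f Y" "f ` X \<inter> f ` Y = {}" for f :: "'a \<times> 'b \<Rightarrow> 'c" and X Y
    using that by (auto simp: inj_on_Un)
  have "inj_on fst C" "inj_on fst D"
    unfolding C_def D_def
    by (intro inj_Un fst_AN_BR fst_AR_BN inj_on_subset[OF A(1)] inj_on_subset[OF B(1)] subs)+
  have "inj_on snd C" "inj_on snd D"
    unfolding C_def D_def
    by (intro inj_Un snd_AN_BR snd_AR_BN inj_on_subset[OF A(2)] inj_on_subset[OF B(2)] subs)+
  have "u \<notin> fst ` C"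
    using uR u by (auto simp: C_def parts)
  have "v \<notin> snd ` C"
  proof
    assume "v \<in> snd ` C"
    then obtain x where x: "x \<in> R" "(x, v) \<in> B"
      using v by (force simp: C_def parts)
    then have "x \<noteq> u"
      using u by force
    then obtain x0 z0 where "(x0, z0) \<in> A" "(x, z0) \<in> B"
      using pred[OF x(1)] by blast
    moreover from this have "z0 = v"
      using inj_onD[OF B(1), of "(x, z0)" "(x, v)"] x(2) by simp
    ultimately show False
      using v by force
  qed
  show thesis
  proof
    show "inj_on fst (insert (u, v) C)" "inj_on snd (insert (u, v) C)"
      using \<open>inj_on fst C\<close> \<open>inj_on snd C\<close> \<open>u \<notin> fst ` C\<close> \<open>v \<notin> snd ` C\<close>
      by (auto simp: inj_on_insert)
    show "inj_on fst D" "inj_on snd D" by fact+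
    show "insert (u, v) C \<union> D = insert (u, v) (A \<union> B)"
      using AB by (auto simp: C_def D_def)
    have "(u, v) \<notin> C"
      using \<open>u \<notin> fst ` C\<close> by force
    moreover have "AN \<inter> BR = {}" "AR \<inter> BN = {}"
      using fst_AN_BR fst_AR_BN by auto
    moreover have "sum w A = sum w AN + sum w AR" "sum w B = sum w BN + sum w BR"
      using sum.union_disjoint[of AN AR w] sum.union_disjoint[of BN BR w] AB fins by simp_all
    ultimately show "sum w (insert (u, v) C) + sum w D = sum w A + sum w B + w (u, v)"
      using fins by (simp add: C_def D_def sum.union_disjoint)
    \<comment> \<open>Pieces of the same matching have disjoint second components, so apart from
      \<open>v\<close> a common second component of the outputs comes from one piece of
      \<open>A\<close> and one piece of \<open>B\<close>. Hence no vertex other than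
      \<open>v\<close> becomes doubly covered.\<close>
    have "snd ` AN \<inter> snd ` AR = {}" "snd ` BN \<inter> snd ` BR = {}"
      using inj_on_image_Int[OF A(2), of AN AR] inj_on_image_Int[OF B(2), of BN BR] AB subs
      by simp_all
    moreover have "insert v (P \<union> Q) \<inter> (P' \<union> Q') \<subseteq> insert v (X \<inter> Y)"
      if "P \<inter> P' = {}" "Q' \<inter> Q = {}" "P \<subseteq> X" "P' \<subseteq> X" "Q' \<subseteq> Y" "Q \<subseteq> Y"
      for P P' Q Q' X Y :: "'b set"
      using that by blast
    ultimately show "snd ` insert (u, v) C \<inter> snd ` D \<subseteq> insert v (snd ` A \<inter> snd ` B)"
      unfolding C_def D_def image_insert image_Un snd_conv
      using subs[THEN image_mono, of snd] by simp
  qed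
qed

section \<open>Optimal matchings and optimal covers\<close>

lemma finite_obtains_maximizer:
  fixes f :: "'b \<Rightarrow> real"
  assumes "finite S" "S \<noteq> {}"
  obtains x where "x \<in> S" "\<And>y. y \<in> S \<Longrightarrow> f y \<le> f x"
proof -
  have "Max (f ` S) \<in> f ` S"
    using assms by simp
  then obtain x where "x \<in> S" "f x = Max (f ` S)"
    by force
  then show thesis
    using that assms(1) by (metis Max_ge finite_imageI imageI)
qed

lemma matching_empty: "matching E {}"
  by (simp add: matching_def)

lemma max_weight_matching_exists:
  assumes "finite E"
  obtains M where "max_weight_matching E w M"
  using finite_obtains_maximizer[OF finite_matchings[OF assms], of "sum w"] matching_empty
  unfolding max_weight_matching_def by (metis empty_iff mem_Collect_eq)

text \<open>Weak duality: a matching counts each vertex at most once, and the vertices that it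
  misses contribute nonnegatively.\<close>

lemma sum_matching_le:
  fixes y :: "'a \<Rightarrow> real"
  assumes "finite U" "finite V" "U \<inter> V = {}"
    and M: "M \<subseteq> U \<times> V" "inj_on fst M" "inj_on snd M"
    and y: "\<forall>q\<in>U \<union> V. 0 \<le> y q"
  shows "(\<Sum>e\<in>M. y (fst e) + y (snd e)) \<le> (\<Sum>q\<in>U \<union> V. y q)"
proof -
  have "(\<Sum>e\<in>M. y (fst e) + y (snd e)) = sum y (fst ` M) + sum y (snd ` M)"
    using M(2,3) by (simp add: sum.distrib sum.reindex)
  also have "\<dots> \<le> sum y U + sum y V"
    using M(1) assms(1,2) y by (intro add_mono sum_mono2) auto
  also have "\<dots> = (\<Sum>q\<in>U \<union> V. y q)"
    using assms(1-3) by (simp add: sum.union_disjoint)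
  finally show ?thesis .
qed

text \<open>Strong duality for bipartite matching by an explicit dual solution. The weight is a
  parameter, since the lemma is later applied to a modified weight.\<close>

lemma optimal_cover_exists:
  fixes w :: "'a \<times> 'a \<Rightarrow> real"
  assumes finU: "finite U" and finV: "finite V" and disj: "U \<inter> V = {}" and E: "E \<subseteq> U \<times> V"
    and M: "max_weight_matching E w M"
  obtains y where "\<forall>q\<in>U \<union> V. 0 \<le> y q"
    "\<forall>e\<in>E. w e \<le> y (fst e) + y (snd e)"
    "(\<Sum>q\<in>U \<union> V. y q) = sum w M"
proof -
  note match_iff = matching_bipartite_iff[OF E disj]
  have finE: "finite E"
    using finU finV E by (meson finite_SigmaI finite_subset)
  have ME: "M \<subseteq> E" and Minj: "inj_on fst M" "inj_on snd M"
    and opt: "\<And>M'. matching E M' \<Longrightarrow> sum w M' \<le> sum w M"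
    using M unfolding max_weight_matching_def match_iff by auto
  have finM: "finite M"
    using ME finE finite_subset by blast
  have "\<exists>N. matching E N \<and> v \<notin> snd ` N \<and>
      (\<forall>N'. matching E N' \<and> v \<notin> snd ` N' \<longrightarrow> sum w N' \<le> sum w N)" for v
  proof -
    have "finite {N. matching E N \<and> v \<notin> snd ` N}"
      using finite_matchings[OF finE] by (rule rev_finite_subset) auto
    moreover have "{} \<in> {N. matching E N \<and> v \<notin> snd ` N}"
      by (simp add: matching_empty)
    ultimately show ?thesis
      using finite_obtains_maximizer[of "{N. matching E N \<and> v \<notin> snd ` N}" "sum w"]
      by (metis (mono_tags, lifting) empty_iff mem_Collect_eq)
  qed
  then obtain N where N: "\<And>v. matching E (N v)" "\<And>v. v \<notin> snd ` N v"
    and Nopt: "\<And>v N'. \<lbrakk>matching E N'; v \<notin> snd ` N'\<rbrakk> \<Longrightarrow> sum w N' \<le> sum w (N v)"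
    by metis
  \<comment> \<open>\<open>N v\<close> is a heaviest matching avoiding \<open>v\<close>, so
    \<open>m v\<close> is the loss in worth when \<open>v\<close> leaves the game.\<close>
  define m where "m v = sum w M - sum w (N v)" for v
  define g where "g u = (let e = the_inv_into M fst u in w e - m (snd e))" for u
  \<comment> \<open>Vertices of \<open>U\<close> missed by \<open>M\<close> get the default 0; those
    of \<open>V\<close> missed by \<open>M\<close> get 0 as well, by
    \<open>m_unmatched\<close>.\<close>
  define y where "y q = (if q \<in> V then m q else if q \<in> fst ` M then g q else 0)" for q
  have g: "g u = w (u, v) - m v" if "(u, v) \<in> M" for u v
    using the_inv_into_f_f[OF Minj(1) that] by (simp add: g_def)
  have sub: "M - {e} \<subseteq> E" "inj_on fst (M - {e})" "inj_on snd (M - {e})" for e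
    using ME Minj by (auto intro: inj_on_diff)
  have removed: "x \<notin> fst ` (M - {(x, z)})" "z \<notin> snd ` (M - {(x, z)})" if "(x, z) \<in> M" for x z
    using inj_on_eq_iff[OF Minj(1) _ that] inj_on_eq_iff[OF Minj(2) _ that] by auto
  have m_nonneg: "0 \<le> m v" for v
    using opt[OF N(1)] by (simp add: m_def)
  have m_unmatched: "m v = 0" if "v \<notin> snd ` M" for v
    using Nopt[of M v] that M m_nonneg[of v] by (simp add: m_def max_weight_matching_def)
  \<comment> \<open>Deleting the edge at \<open>v\<close> from \<open>M\<close> yields a competitor
    of \<open>N v\<close>. This makes the share of the partner \<open>u\<close> nonnegative.\<close>
  have m_le: "m v \<le> w (u, v)" if "(u, v) \<in> M" for u v
  proof -
    have "sum w (M - {(u, v)}) \<le> sum w (N v)"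
      using removed(2)[OF that] sub by (intro Nopt) (auto simp: match_iff)
    then show ?thesis
      using that finM by (simp add: m_def sum_diff1)
  qed
  have yV: "y q = m q" if "q \<in> V" for q
    using that by (simp add: y_def)
  have yM: "y u = w (u, v) - m v" if "(u, v) \<in> M" for u v
  proof -
    have "u \<notin> V" "u \<in> fst ` M"
      using that ME E disj by force+
    then show ?thesis
      using g[OF that] by (simp add: y_def)
  qed
  show thesis
  proof
    show "\<forall>q\<in>U \<union> V. 0 \<le> y q"
      using m_nonneg m_le g by (auto simp: y_def)
    show "\<forall>e\<in>E. w e \<le> y (fst e) + y (snd e)"
    proof
      fix e assume "e \<in> E"
      obtain u v where e: "e = (u, v)" by force
      have uv: "u \<in> U" "v \<in> V" "(u, v) \<in> E"
        using \<open>e \<in> E\<close> E e by auto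
      have Ninj: "N v \<subseteq> E" "inj_on fst (N v)" "inj_on snd (N v)" "finite (N v)"
        using N(1)[of v] finE by (auto simp: match_iff finite_subset)
      consider (unmatched) "u \<notin> fst ` M" | (inM) "(u, v) \<in> M"
        | (other) z where "(u, z) \<in> M" "z \<noteq> v"
        by fastforce
      then have "w (u, v) \<le> y u + y v"
      proof cases
        \<comment> \<open>Adding \<open>(u, v)\<close> to \<open>N v\<close> and \<open>M\<close>
          gives two matchings, each of weight at most \<open>sum w M\<close>; hence
          \<open>w (u, v) \<le> m v\<close>.\<close>
        case unmatched
        obtain A B where AB: "inj_on fst A" "inj_on snd A" "inj_on fst B" "inj_on snd B"
          "A \<union> B = insert (u, v) (N v \<union> M)"
          "sum w A + sum w B = sum w (N v) + sum w M + w (u, v)"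
          "snd ` A \<inter> snd ` B \<subseteq> insert v (snd ` N v \<inter> snd ` M)"
          by (rule augment_two_injective[OF Ninj(4) finM Ninj(2,3) Minj unmatched N(2)])
        then have "A \<subseteq> E" "B \<subseteq> E"
          using Ninj(1) ME uv by auto
        then have "sum w A \<le> sum w M" "sum w B \<le> sum w M"
          using AB opt match_iff by auto
        moreover have "y u = 0"
          using uv disj unmatched by (auto simp: y_def)
        ultimately show ?thesis
          using AB(6) yV[OF uv(2)] by (simp add: m_def)
      next
        case inM
        then show ?thesis
          using yM yV uv by simp
      next
        \<comment> \<open>Deleting \<open>(u, z)\<close> from \<open>M\<close> frees
          \<open>u\<close> for the exchange. One of the two outputs still misses \<open>z\<close>,
          so it is bounded by \<open>N z\<close> and the other one by \<open>M\<close>; rearranging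
          gives \<open>w (u, v) \<le> w (u, z) - m z + m v\<close>.\<close>
        case other
        note rem = removed[OF other(1)]
        obtain A B where AB: "inj_on fst A" "inj_on snd A" "inj_on fst B" "inj_on snd B"
          "A \<union> B = insert (u, v) (N v \<union> (M - {(u, z)}))"
          "sum w A + sum w B = sum w (N v) + sum w (M - {(u, z)}) + w (u, v)"
          "snd ` A \<inter> snd ` B \<subseteq> insert v (snd ` N v \<inter> snd ` (M - {(u, z)}))"
          by (rule augment_two_injective
              [OF Ninj(4) finite_Diff[OF finM] Ninj(2,3) sub(2,3) rem(1) N(2)])
        then have "A \<subseteq> E" "B \<subseteq> E"
          using Ninj(1) ME uv by auto
        then have mat: "matching E A" "matching E B"
          using AB match_iff by auto
        have "z \<notin> snd ` A \<or> z \<notin> snd ` B"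
          using AB(7) rem(2) other(2) by blast
        then have "sum w A + sum w B \<le> sum w (N z) + sum w M"
          using mat opt Nopt by (metis add.commute add_mono)
        moreover have "sum w (M - {(u, z)}) = sum w M - w (u, z)"
          using other(1) finM by (simp add: sum_diff1)
        ultimately show ?thesis
          using AB(6) yV[OF uv(2)] yM[OF other(1)] by (simp add: m_def)
      qed
      then show "w e \<le> y (fst e) + y (snd e)"
        by (simp add: e)
    qed
    have fU: "fst ` M \<subseteq> U" and sV: "snd ` M \<subseteq> V"
      using ME E by auto
    have "sum y U = sum y (fst ` M)"
      using fU finU disj by (intro sum.mono_neutral_right) (auto simp: y_def)
    moreover have "sum y V = sum y (snd ` M)"
      using sV finV m_unmatched by (intro sum.mono_neutral_right) (auto simp: yV)
    ultimately have "(\<Sum>q\<in>U \<union> V. y q) = (\<Sum>e\<in>M. y (fst e) + y (snd e))"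
      using Minj finU finV disj by (simp add: sum.union_disjoint sum.distrib sum.reindex)
    also have "\<dots> = sum w M"
      using ME E yM yV by (intro sum.cong) auto
    finally show "(\<Sum>q\<in>U \<union> V. y q) = sum w M" .
  qed
qed

section \<open>The core as the set of optimal covers\<close>

lemma sum_le_worth:
  assumes "finite E" "matching (E \<inter> Su \<times> Sv) M"
  shows "sum w M \<le> worth E w Su Sv"
  unfolding worth_def using finite_matchings[of "E \<inter> Su \<times> Sv"] assms
  by (intro Max_ge) (auto simp: setcompr_eq_image)

text \<open>The coalitions consisting of the two ends of an edge give the covering inequalities;
  conversely, these give every coalition inequality by weak duality on the induced subgraph.\<close>

lemma core_iff_cover:
  assumes "finite U" "finite V" "U \<inter> V = {}" and E: "E \<subseteq> U \<times> V"
    and M: "max_weight_matching E w M"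
  shows "y \<in> core U V E w \<longleftrightarrow> (\<forall>q\<in>U \<union> V. 0 \<le> y q) \<and>
    (\<forall>e\<in>E. w e \<le> y (fst e) + y (snd e)) \<and> (\<Sum>q\<in>U \<union> V. y q) = sum w M"
proof -
  have finE: "finite E"
    using assms by (meson finite_SigmaI finite_subset)
  have "E \<inter> U \<times> V = E"
    using E by auto
  then have worth: "worth E w U V = sum w M"
    using worth_eq_iff[OF finE, of U V M w] M by (simp add: max_weight_matching_def)
  have cover: "w e \<le> y (fst e) + y (snd e)" if "y \<in> core U V E w" "e \<in> E" for e
  proof -
    obtain u v where e: "e = (u, v)" by force
    have uv: "u \<in> U" "v \<in> V" "u \<noteq> v"
      using that(2) E assms(3) e by auto
    have "matching (E \<inter> {u} \<times> {v}) {e}"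
      using that(2) e by (simp add: matching_def)
    then have "w e \<le> worth E w {u} {v}"
      using sum_le_worth[OF finE, of _ _ "{e}" w] by simp
    also have "\<dots> \<le> (\<Sum>q\<in>{u} \<union> {v}. y q)"
    proof -
      have "\<forall>Su Sv. Su \<subseteq> U \<longrightarrow> Sv \<subseteq> V \<longrightarrow> worth E w Su Sv \<le> (\<Sum>q\<in>Su \<union> Sv. y q)"
        using that(1) by (simp add: core_def)
      from this[rule_format, of "{u}" "{v}"] show ?thesis
        using uv by simp
    qed
    finally show ?thesis
      using uv e by simp
  qed
  have coalition: "worth E w Su Sv \<le> (\<Sum>q\<in>Su \<union> Sv. y q)"
    if y: "\<forall>q\<in>U \<union> V. 0 \<le> y q" "\<forall>e\<in>E. w e \<le> y (fst e) + y (snd e)"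
      and S: "Su \<subseteq> U" "Sv \<subseteq> V" for Su Sv
  proof -
    have finS: "finite Su" "finite Sv" "Su \<inter> Sv = {}"
      using S assms(1-3) finite_subset by blast+
    obtain N where N: "max_weight_matching (E \<inter> Su \<times> Sv) w N"
      using max_weight_matching_exists finE by blast
    then have mat: "matching (E \<inter> Su \<times> Sv) N"
      by (simp add: max_weight_matching_def)
    then have NE: "N \<subseteq> E" "N \<subseteq> Su \<times> Sv" "inj_on fst N" "inj_on snd N"
      using matching_bipartite_iff[of "E \<inter> Su \<times> Sv" Su Sv N] finS by auto
    have "worth E w Su Sv = sum w N"
      using worth_eq_iff[OF finE mat, of w] N by simp
    also have "\<dots> \<le> (\<Sum>e\<in>N. y (fst e) + y (snd e))"
      using y(2) NE(1) by (intro sum_mono) auto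
    also have "\<dots> \<le> (\<Sum>q\<in>Su \<union> Sv. y q)"
      using y(1) S by (intro sum_matching_le finS NE) auto
    finally show ?thesis .
  qed
  show ?thesis
    using cover coalition worth by (auto simp: core_def imputation_def)
qed

section \<open>Teams that are always paid fairly\<close>

theorem theorem4:
  fixes U V :: "'a set" and E :: "('a \<times> 'a) set" and w :: "'a \<times> 'a \<Rightarrow> real"
  assumes "assignment_game U V E w"
    and "e \<in> E"
  shows "always_paid_fairly U V E w e \<longleftrightarrow> viable E w e \<or> essential E w e"
proof -
  interpret assignment_game U V E w by fact
  note bip = finite_U finite_V disjoint edges
  have finE: "finite E"
    using bip by (meson finite_SigmaI finite_subset)
  obtain M0 where M0: "max_weight_matching E w M0"
    using max_weight_matching_exists[OF finE] .
  have "viable E w e \<or> essential E w e \<longleftrightarrow> (\<exists>M. max_weight_matching E w M \<and> e \<in> M)"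
    using M0 by (auto simp: viable_def essential_def)
  moreover have "fairly_paid w y e"
    if M: "max_weight_matching E w M" "e \<in> M" and y: "y \<in> core U V E w" for M y
  proof -
    note y' = y[unfolded core_iff_cover[OF bip M(1)]]
    have ME: "M \<subseteq> E" "inj_on fst M" "inj_on snd M"
      using M matching_bipartite_iff[OF edges disjoint] by (auto simp: max_weight_matching_def)
    \<comment> \<open>Complementary slackness: the slacks along \<open>M\<close> are nonnegative and
      their total is at most 0, so each of them vanishes.\<close>
    have slack: "0 \<le> y (fst f) + y (snd f) - w f" if "f \<in> M" for f
      using that y' ME by auto
    have "(\<Sum>f\<in>M. y (fst f) + y (snd f)) \<le> sum w M"
      using sum_matching_le[OF finite_U finite_V disjoint _ ME(2,3), of y] ME(1) edges y' by auto
    then have "(\<Sum>f\<in>M. y (fst f) + y (snd f) - w f) \<le> 0"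
      by (simp add: sum_subtractf)
    then have "(\<Sum>f\<in>M. y (fst f) + y (snd f) - w f) = 0"
      using slack by (meson antisym sum_nonneg)
    then have "y (fst e) + y (snd e) - w e = 0"
      using sum_nonneg_eq_0_iff[of M "\<lambda>f. y (fst f) + y (snd f) - w f"] slack M(2) ME(1) finE
      by (meson finite_subset)
    then show ?thesis
      by (simp add: fairly_paid_def)
  qed
  moreover have "\<not> always_paid_fairly U V E w e"
    if none: "\<And>M. max_weight_matching E w M \<Longrightarrow> e \<notin> M"
  proof -
    have opt: "\<And>M. matching E M \<Longrightarrow> sum w M \<le> sum w M0"
      using M0 by (simp add: max_weight_matching_def)
    have "finite {M. matching E M \<and> e \<in> M}"
      using finite_matchings[OF finE] by (rule rev_finite_subset) auto
    moreover have "{e} \<in> {M. matching E M \<and> e \<in> M}"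
      using assms(2) by (simp add: matching_def)
    ultimately obtain K where K: "matching E K" "e \<in> K"
      and Kopt: "\<And>M. \<lbrakk>matching E M; e \<in> M\<rbrakk> \<Longrightarrow> sum w M \<le> sum w K"
      using finite_obtains_maximizer[of "{M. matching E M \<and> e \<in> M}" "sum w"]
      by (metis (mono_tags, lifting) empty_iff mem_Collect_eq)
    \<comment> \<open>\<open>K\<close> is a heaviest matching through \<open>e\<close>. Raising
      \<open>w e\<close> by exactly this gap lifts \<open>K\<close> to the weight of
      \<open>M0\<close>, so \<open>M0\<close> stays optimal; as \<open>e\<close> is not in
      \<open>M0\<close>, the worth is unchanged.\<close>
    define \<epsilon> where "\<epsilon> = sum w M0 - sum w K"
    define w' where "w' = w(e := w e + \<epsilon>)"
    have "\<not> max_weight_matching E w K"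
      using none K(2) by blast
    then obtain M1 where "matching E M1" "sum w K < sum w M1"
      using K(1) by (auto simp: max_weight_matching_def not_le)
    then have "0 < \<epsilon>"
      using opt[of M1] by (simp add: \<epsilon>_def)
    have sum_w': "sum w' M = sum w M + (if e \<in> M then \<epsilon> else 0)" if "matching E M" for M
    proof -
      have "finite M"
        using that finE by (auto simp: matching_def intro: finite_subset)
      moreover have "w' = (\<lambda>f. w f + (if f = e then \<epsilon> else 0))"
        by (auto simp: w'_def)
      ultimately show ?thesis
        by (simp add: sum.distrib)
    qed
    have mat0: "matching E M0"
      using M0 by (simp add: max_weight_matching_def)
    have sum0: "sum w' M0 = sum w M0"
      using sum_w'[OF mat0] none[OF M0] by simp
    have "sum w' M \<le> sum w' M0" if "matching E M" for M
      using sum_w'[OF that] sum0 opt[OF that] Kopt[OF that] by (auto simp: \<epsilon>_def)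
    then have "max_weight_matching E w' M0"
      using mat0 by (simp add: max_weight_matching_def)
    then obtain y where y: "\<forall>q\<in>U \<union> V. 0 \<le> y q"
      "\<forall>f\<in>E. w' f \<le> y (fst f) + y (snd f)" "(\<Sum>q\<in>U \<union> V. y q) = sum w' M0"
      using optimal_cover_exists[OF bip] by metis
    have "w f \<le> w' f" for f
      using \<open>0 < \<epsilon>\<close> by (simp add: w'_def)
    then have "y \<in> core U V E w"
      using y sum0 unfolding core_iff_cover[OF bip M0] by (metis order_trans)
    moreover have "w e < y (fst e) + y (snd e)"
      using y(2) assms(2) \<open>0 < \<epsilon>\<close> by (force simp: w'_def)
    ultimately show ?thesis
      by (force simp: always_paid_fairly_def fairly_paid_def)
  qed
  ultimately show ?thesis
    unfolding always_paid_fairly_def by blast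
qed

end
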